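(* Every transshipment problem $(G,d,\lambda)$ with $\sum_{v\in V}d_v=0$ and containing no fatal cut has a unique lexmin solution, that is, it has exactly one balanced flow.
   Context: A transshipment problem $(G,d,\lambda)$ consists of a finite directed graph $G=(V,E)$ whose arcs $e=(u,v)$ have tail $u$ and head $v$ with $u\neq v$, real node weights $d=(d_v\mid v\in V)$, and positive real arc capacities $\lambda=(\lambda_e\mid e\in E)$. A flow is a vector $x=(x_e\mid e\in E)$ of nonnegative reals. A flow is weakly feasible if for each node $v$, (total flow on arcs leaving $v$) minus (total flow on arcs entering $v$) equals $d_v$; capacities need not be respected. A cut is an ordered pair $C=(V',V'')$ of nonempty disjoint sets with $V'\cup V''=V$; $E_C$ is the set of arcs with tail in $V'$ and head in $V''$; $d_C=\sum_{v\in V'}d_v$, $\lambda_C=\sum_{e\in E_C}\lambda_e$. The cut is fatal if $d_C>0$ and $\lambda_C=0$. (A problem with node weights summing to zero has a weakly feasible flow if and only if it has no fatal cut.) For a flow $x$ put $r(x)=(x_e/\lambda_e\mid e\in E)$. A balanced flow, or lexmin solution, is a weakly feasible flow $x$ that lexicographically minimizes $r(x)$ in the following sense: among all weakly feasible flows it minimizes the largest coordinate of $r(x)$, among all such minimizers it minimizes the second largest coordinate, and so on; equivalently, the vector of coordinates of $r(x)$ sorted in nonincreasing order is lexicographically smallest among all weakly feasible flows. *)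

theory Defs
  imports Complex_Main "HOL-Library.FuncSet" "HOL-Library.Multiset" "Graph_Theory.Digraph"
begin

(* d is unconstrained and hence no argument: a transshipment problem (G, d, cap) consists of such
   G and cap together with any d :: 'a \<Rightarrow> real.  Arcs are abstract objects with tail and head, so
   parallel arcs are allowed; a graph whose arcs are ordered pairs is the special case
   tail = fst, head = snd. *)
locale capacitated_digraph = fin_digraph G + loopfree_digraph G
  for G :: "('a, 'b) pre_digraph" +
  fixes cap :: "'b \<Rightarrow> real"
  assumes cap_pos: "e \<in> arcs G \<Longrightarrow> cap e > 0"

(* Extensionality makes equality of flows the same as equality of vectors indexed by the arcs. *)
definition flow :: "('a, 'b) pre_digraph \<Rightarrow> ('b \<Rightarrow> real) \<Rightarrow> bool" where
  "flow G x \<longleftrightarrow> x \<in> arcs G \<rightarrow>\<^sub>E {0..}"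

definition weakly_feasible ::
    "('a, 'b) pre_digraph \<Rightarrow> ('a \<Rightarrow> real) \<Rightarrow> ('b \<Rightarrow> real) \<Rightarrow> bool" where
  "weakly_feasible G d x \<longleftrightarrow> flow G x \<and>
     (\<forall>v \<in> verts G. (\<Sum>e \<in> out_arcs G v. x e) - (\<Sum>e \<in> in_arcs G v. x e) = d v)"

definition is_cut :: "('a, 'b) pre_digraph \<Rightarrow> 'a set \<times> 'a set \<Rightarrow> bool" where
  "is_cut G C \<longleftrightarrow> fst C \<noteq> {} \<and> snd C \<noteq> {} \<and> fst C \<inter> snd C = {} \<and> fst C \<union> snd C = verts G"

definition cut_arcs :: "('a, 'b) pre_digraph \<Rightarrow> 'a set \<times> 'a set \<Rightarrow> 'b set" where
  "cut_arcs G C = {e \<in> arcs G. tail G e \<in> fst C \<and> head G e \<in> snd C}"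

definition cut_demand :: "('a \<Rightarrow> real) \<Rightarrow> 'a set \<times> 'a set \<Rightarrow> real" where
  "cut_demand d C = (\<Sum>v \<in> fst C. d v)"

definition cut_capacity ::
    "('a, 'b) pre_digraph \<Rightarrow> ('b \<Rightarrow> real) \<Rightarrow> 'a set \<times> 'a set \<Rightarrow> real" where
  "cut_capacity G cap C = (\<Sum>e \<in> cut_arcs G C. cap e)"

definition fatal_cut ::
    "('a, 'b) pre_digraph \<Rightarrow> ('a \<Rightarrow> real) \<Rightarrow> ('b \<Rightarrow> real) \<Rightarrow> 'a set \<times> 'a set \<Rightarrow> bool" where
  "fatal_cut G d cap C \<longleftrightarrow> is_cut G C \<and> cut_demand d C > 0 \<and> cut_capacity G cap C = 0"

(* The coordinates of the vector r(x), with multiplicity, in nonincreasing order. *)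
definition sorted_ratios ::
    "('a, 'b) pre_digraph \<Rightarrow> ('b \<Rightarrow> real) \<Rightarrow> ('b \<Rightarrow> real) \<Rightarrow> real list" where
  "sorted_ratios G cap x =
     rev (sorted_list_of_multiset (image_mset (\<lambda>e. x e / cap e) (mset_set (arcs G))))"

(* lexordp_eq is the reflexive lexicographic order; the lists compared all have length
   card (arcs G), so its treatment of proper prefixes plays no role. *)
definition balanced_flow ::
    "('a, 'b) pre_digraph \<Rightarrow> ('a \<Rightarrow> real) \<Rightarrow> ('b \<Rightarrow> real) \<Rightarrow> ('b \<Rightarrow> real) \<Rightarrow> bool" where
  "balanced_flow G d cap x \<longleftrightarrow> weakly_feasible G d x \<and>
     (\<forall>y. weakly_feasible G d y \<longrightarrow>
        ord_class.lexordp_eq (sorted_ratios G cap x) (sorted_ratios G cap y))"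

end

theory Submission
  imports Defs "HOL-Analysis.Function_Topology"
begin

text \<open>
  Three ideas carry the proof.
  
  \<^bold>\<open>A weakly feasible flow exists\<close> (\<open>exists_weakly_feasible\<close>). Call a set of nodes out-closed if no arc
  leaves it. Absence of fatal cuts says that every out-closed set has total weight at most zero. While some
  node weight is nonzero, a supply node can send a positive amount along a walk to a demand node without
  violating these inequalities; the walk is chosen inside a minimal set for which the inequality is
  tight. Sending as much as possible either settles a node or makes a further inequality tight, so
  finitely many shipments reduce all weights to zero, and their sum is the flow.
  
  \<^bold>\<open>A lexicographic minimizer exists\<close> (\<open>balanced_flow_exists\<close>). Comparing sorted vectors
  lexicographically amounts to comparing their prefix sums lexicographically, and the sum of the \<open>k\<close>
  largest ratios is the maximum over all \<open>k\<close>-element arc sets of the sum of the ratios in the set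
  (\<open>top_sum_eq_prefix_sum\<close>). In this form it is visibly continuous, so successive minimization over
  the compact set of weakly feasible flows with bounded ratios yields a minimizer.
  
  \<^bold>\<open>The minimizer is unique\<close> (\<open>balanced_flow_unique\<close>). The maxima above are also convex. If \<open>x\<close> and \<open>y\<close>
  are minimizers, their sorted ratio vectors coincide, and the prefix sums of the midpoint \<open>z\<close> are at
  most theirs. By minimality \<open>z\<close> has the same sorted ratio vector as well. Hence the ratio vectors of
  \<open>x\<close>, \<open>y\<close> and \<open>z\<close> have the same Euclidean norm, and the parallelogram law forces \<open>x = y\<close>.
\<close>

section \<open>Weakly feasible flows\<close>

definition net_outflow :: "('a, 'b) pre_digraph \<Rightarrow> ('b \<Rightarrow> real) \<Rightarrow> 'a \<Rightarrow> real" where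
  "net_outflow G x v = (\<Sum>e \<in> out_arcs G v. x e) - (\<Sum>e \<in> in_arcs G v. x e)"

definition out_closed :: "('a, 'b) pre_digraph \<Rightarrow> 'a set \<Rightarrow> bool" where
  "out_closed G X \<longleftrightarrow> X \<subseteq> verts G \<and> (\<forall>e \<in> arcs G. tail G e \<in> X \<longrightarrow> head G e \<in> X)"

lemma net_outflow_add:
  "net_outflow G (\<lambda>e. x e + y e) v = net_outflow G x v + net_outflow G y v"
  by (simp add: net_outflow_def sum.distrib)

lemma net_outflow_mult: "net_outflow G (\<lambda>e. c * x e) v = c * net_outflow G x v"
  by (simp add: net_outflow_def sum_distrib_left[symmetric] right_diff_distrib)

lemma net_outflow_cong:
  assumes "\<And>e. e \<in> arcs G \<Longrightarrow> x e = y e"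
  shows "net_outflow G x v = net_outflow G y v"
proof -
  have "(\<Sum>e \<in> out_arcs G v. x e) = (\<Sum>e \<in> out_arcs G v. y e)"
    using assms by (intro sum.cong) auto
  moreover have "(\<Sum>e \<in> in_arcs G v. x e) = (\<Sum>e \<in> in_arcs G v. y e)"
    using assms by (intro sum.cong) auto
  ultimately show ?thesis by (simp add: net_outflow_def)
qed

lemma weakly_feasible_altdef:
  "weakly_feasible G d x \<longleftrightarrow> flow G x \<and> (\<forall>v \<in> verts G. net_outflow G x v = d v)"
  by (simp add: weakly_feasible_def net_outflow_def)

lemma out_closed_reachable:
  assumes "out_closed G X" "(u, w) \<in> (arcs_ends G)\<^sup>*" "u \<in> X"
  shows "w \<in> X"
  using assms(2,3) by induction (use assms(1) in \<open>auto simp: out_closed_def arcs_ends_conv\<close>)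

context fin_digraph
begin

lemma net_outflow_single_arc:
  assumes "e \<in> arcs G"
  shows "net_outflow G (\<lambda>a. if a = e then c else 0) v =
    (if v = tail G e then c else 0) - (if v = head G e then c else 0)"
proof -
  have "finite (out_arcs G v)" "finite (in_arcs G v)" by auto
  then show ?thesis
    using assms by (auto simp: net_outflow_def sum.delta')
qed

text \<open>
  The witness repeats an arc as often as the walk does, so that the walk need not be simplified to a path.
\<close>

lemma flow_along_walk:
  assumes "(u, w) \<in> (arcs_ends G)\<^sup>*" "c \<ge> 0"
  shows "\<exists>y. (\<forall>e. y e \<ge> 0) \<and>
    (\<forall>v. net_outflow G y v = (if v = u then c else 0) - (if v = w then c else 0))"
  using assms(1)
proof induction
  case base
  show ?case by (rule exI[of _ "\<lambda>_. 0"]) (simp add: net_outflow_def)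
next
  case (step w w')
  then obtain y where y: "\<And>e. y e \<ge> 0"
    "\<And>v. net_outflow G y v = (if v = u then c else 0) - (if v = w then c else 0)" by blast
  from step(2) obtain e where e: "e \<in> arcs G" "tail G e = w" "head G e = w'"
    by (auto simp: arcs_ends_conv)
  define z where "z = (\<lambda>a. y a + (if a = e then c else 0))"
  have "net_outflow G z v = (if v = u then c else 0) - (if v = w' then c else 0)" for v
    unfolding z_def net_outflow_add net_outflow_single_arc[OF e(1)] y(2) e(2,3) by simp
  moreover have "z a \<ge> 0" for a using y(1)[of a] assms(2) by (simp add: z_def)
  ultimately show ?case by blast
qed

text \<open>
  The induction counts the out-closed sets of negative weight and the nodes of nonzero weight. Shipping an
  amount from \<open>u\<close> to a node \<open>w\<close> reachable from it changes the weight of an out-closed set only if the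
  set contains \<open>w\<close> but not \<open>u\<close>, and then raises it. Neither count can therefore grow, and the largest
  admissible shipment makes one of them drop.
\<close>

lemma exists_nonneg_with_net_outflow:
  assumes "(\<Sum>v \<in> verts G. d v) = 0"
    and "\<And>X. out_closed G X \<Longrightarrow> (\<Sum>v \<in> X. d v) \<le> 0"
  shows "\<exists>y. (\<forall>e. y e \<ge> 0) \<and> (\<forall>v \<in> verts G. net_outflow G y v = d v)"
  using assms
proof (induction "card {X. out_closed G X \<and> (\<Sum>v \<in> X. d v) < 0} + card {v \<in> verts G. d v \<noteq> 0}"
    arbitrary: d rule: less_induct)
  case less
  show ?case
  proof (cases "\<forall>v \<in> verts G. d v = 0")
    case True
    then show ?thesis by (intro exI[of _ "\<lambda>_. 0"]) (simp add: net_outflow_def)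
  next
    case False
    have closed_sub: "{X. out_closed G X \<and> P X} \<subseteq> Pow (verts G)" for P
      by (auto simp: out_closed_def)
    then have fin_closed: "finite {X. out_closed G X \<and> P X}" for P
      by (rule finite_subset) simp
    have fin: "finite X" if "out_closed G X" for X
      using that finite_subset[OF _ finite_verts] by (auto simp: out_closed_def)
    define tight where
      "tight = {X. out_closed G X \<and> (\<Sum>v \<in> X. d v) = 0 \<and> (\<exists>v \<in> X. d v \<noteq> 0)}"
    have "out_closed G (verts G)" by (auto simp: out_closed_def)
    then have "verts G \<in> tight" using False less.prems(1) by (auto simp: tight_def)
    moreover have "finite tight" unfolding tight_def by (rule fin_closed)
    ultimately obtain X where X: "X \<in> tight" and X_min: "\<And>Y. Y \<in> tight \<Longrightarrow> Y \<subseteq> X \<Longrightarrow> X = Y"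
      using finite_has_minimal[of tight] by auto
    have Xc: "out_closed G X" and X0: "(\<Sum>v \<in> X. d v) = 0" using X by (auto simp: tight_def)
    \<comment> \<open>Weights in a tight set sum to zero, so one that is nonzero comes with a positive one.\<close>
    have "\<exists>u \<in> X. d u > 0"
    proof (rule ccontr)
      assume "\<not> ?thesis"
      then have "\<And>v. v \<in> X \<Longrightarrow> - d v \<ge> 0" by (auto simp: not_less)
      moreover have "(\<Sum>v \<in> X. - d v) = 0" using X0 by (simp add: sum_negf)
      ultimately have "\<forall>v \<in> X. - d v = 0"
        using sum_nonneg_eq_0_iff[OF fin[OF Xc], of "\<lambda>v. - d v"] by blast
      then show False using X by (auto simp: tight_def)
    qed
    then obtain u where u: "u \<in> X" "d u > 0" by blast
    have uV: "u \<in> verts G" using u(1) Xc by (auto simp: out_closed_def)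
    define R where "R = (arcs_ends G)\<^sup>* `` {u}"
    have "R \<subseteq> verts G"
      using out_closed_reachable[OF \<open>out_closed G (verts G)\<close>] uV by (auto simp: R_def)
    moreover have "head G e \<in> R" if "e \<in> arcs G" "tail G e \<in> R" for e
      using that rtrancl_into_rtrancl[of u "tail G e" "arcs_ends G" "head G e"]
      by (auto simp: R_def arcs_ends_conv)
    ultimately have Rc: "out_closed G R" by (auto simp: out_closed_def)
    have "\<exists>w \<in> R. d w < 0"
    proof (rule ccontr)
      assume "\<not> ?thesis"
      then have "d u \<le> (\<Sum>v \<in> R. d v)"
        using fin[OF Rc] by (intro member_le_sum) (auto simp: not_less R_def)
      then show False using less.prems(2)[OF Rc] u(2) by simp
    qed
    then obtain w where w: "w \<in> R" "d w < 0" by blast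
    have uw: "(u, w) \<in> (arcs_ends G)\<^sup>*" using w(1) by (simp add: R_def)
    have wV: "w \<in> verts G" using w(1) Rc by (auto simp: out_closed_def)
    have ne: "u \<noteq> w" using u(2) w(2) by auto
    \<comment> \<open>The bounds that keep the weights of \<open>u\<close> and \<open>w\<close> from changing sign and all out-closed
      sets at weight at most zero.\<close>
    define D where "D = {d u, - d w} \<union>
      (\<lambda>Y. - (\<Sum>v \<in> Y. d v)) ` {Y. out_closed G Y \<and> w \<in> Y \<and> u \<notin> Y}"
    have finD: "finite D" "D \<noteq> {}" using fin_closed by (auto simp: D_def)
    \<comment> \<open>This is where minimality of \<open>X\<close> matters: a tight \<open>Y\<close> with \<open>w\<close> but not \<open>u\<close> would block every shipment,
      but then \<open>X \<inter> Y\<close> would be a smaller tight set by modularity of the weight.\<close>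
    have neg: "(\<Sum>v \<in> Y. d v) < 0" if Y: "out_closed G Y" "w \<in> Y" "u \<notin> Y" for Y
    proof (rule ccontr)
      assume "\<not> ?thesis"
      then have Y0: "(\<Sum>v \<in> Y. d v) = 0" using less.prems(2)[OF Y(1)] by simp
      have c: "out_closed G (X \<inter> Y)" "out_closed G (X \<union> Y)"
        using Xc Y(1) by (auto simp: out_closed_def)
      have "(\<Sum>v \<in> X \<union> Y. d v) + (\<Sum>v \<in> X \<inter> Y. d v) = 0"
        using sum.union_inter[OF fin[OF Xc] fin[OF Y(1)], of d] X0 Y0 by simp
      then have "(\<Sum>v \<in> X \<inter> Y. d v) = 0"
        using less.prems(2)[OF c(1)] less.prems(2)[OF c(2)] by simp
      moreover have "w \<in> X \<inter> Y" using out_closed_reachable[OF Xc uw u(1)] Y(2) by simp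
      moreover from this have "\<exists>v \<in> X \<inter> Y. d v \<noteq> 0" using w(2) by (intro bexI[of _ w]) auto
      ultimately have "X \<inter> Y \<in> tight" using c(1) by (simp add: tight_def)
      then show False using X_min[of "X \<inter> Y"] u(1) Y(3) by blast
    qed
    define \<delta> where "\<delta> = Min D"
    have \<delta>D: "\<delta> \<in> D" using finD by (simp add: \<delta>_def)
    have "\<forall>t \<in> D. t > 0" using u(2) w(2) neg by (auto simp: D_def)
    then have \<delta>: "\<delta> > 0" using \<delta>D by blast
    have \<delta>_le: "\<delta> \<le> t" if "t \<in> D" for t using that finD by (simp add: \<delta>_def)
    \<comment> \<open>The weights that remain to be realized after the shipment.\<close>
    define d' where
      "d' = (\<lambda>v. d v - ((if v = u then \<delta> else 0) - (if v = w then \<delta> else 0)))"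
    have sum_d': "(\<Sum>v \<in> Y. d' v) =
        (\<Sum>v \<in> Y. d v) - ((if u \<in> Y then \<delta> else 0) - (if w \<in> Y then \<delta> else 0))"
      if "finite Y" for Y
      using that by (simp add: d'_def sum_subtractf)
    have sum_d'_closed: "(\<Sum>v \<in> Y. d' v) =
        (\<Sum>v \<in> Y. d v) + (if w \<in> Y \<and> u \<notin> Y then \<delta> else 0)" if "out_closed G Y" for Y
      using sum_d'[OF fin[OF that]] out_closed_reachable[OF that uw] by auto
    have le0: "(\<Sum>v \<in> Y. d' v) \<le> 0" if Y: "out_closed G Y" for Y
    proof (cases "w \<in> Y \<and> u \<notin> Y")
      case True
      then have "- (\<Sum>v \<in> Y. d v) \<in> D" using Y by (auto simp: D_def)
      then show ?thesis using \<delta>_le sum_d'_closed[OF Y] True by fastforce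
    next
      case False
      then show ?thesis using sum_d'_closed[OF Y] less.prems(2)[OF Y] by auto
    qed
    let ?A = "\<lambda>d. {X. out_closed G X \<and> (\<Sum>v \<in> X. d v) < 0}"
    let ?B = "\<lambda>d. {v \<in> verts G. d v \<noteq> 0}"
    have A: "?A d' \<subseteq> ?A d" using sum_d'_closed \<delta> by (auto split: if_splits)
    have B: "?B d' \<subseteq> ?B d" using u(2) w(2) by (auto simp: d'_def split: if_splits)
    have finA: "finite (?A d)" and finB: "finite (?B d)" using fin_closed by auto
    consider "\<delta> = d u" | "\<delta> = - d w"
      | Y where "out_closed G Y" "w \<in> Y" "u \<notin> Y" "\<delta> = - (\<Sum>v \<in> Y. d v)"
      using \<delta>D by (auto simp: D_def)
    then have "?A d' \<subset> ?A d \<or> ?B d' \<subset> ?B d"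
    proof cases
      case 1
      then have "u \<in> ?B d - ?B d'" using ne u(2) uV by (auto simp: d'_def)
      then show ?thesis using B by blast
    next
      case 2
      then have "w \<in> ?B d - ?B d'" using ne w(2) wV by (auto simp: d'_def)
      then show ?thesis using B by blast
    next
      case (3 Y)
      then have "Y \<in> ?A d - ?A d'" using sum_d'_closed[OF 3(1)] \<delta> by auto
      then show ?thesis using A by blast
    qed
    then have "card (?A d') + card (?B d') < card (?A d) + card (?B d)"
      using card_mono[OF finA A] card_mono[OF finB B]
        psubset_card_mono[OF finA, of "?A d'"] psubset_card_mono[OF finB, of "?B d'"]
      by linarith
    moreover have "(\<Sum>v \<in> verts G. d' v) = 0"
      using sum_d'[OF finite_verts] less.prems(1) uV wV by simp
    ultimately obtain y where y: "\<And>e. y e \<ge> 0" "\<And>v. v \<in> verts G \<Longrightarrow> net_outflow G y v = d' v"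
      using less.hyps[of d'] le0 by blast
    obtain z where z: "\<And>e. z e \<ge> 0"
      "\<And>v. net_outflow G z v = (if v = u then \<delta> else 0) - (if v = w then \<delta> else 0)"
      using flow_along_walk[OF uw, of \<delta>] \<delta> by auto
    have "net_outflow G (\<lambda>e. y e + z e) v = d v" if "v \<in> verts G" for v
      unfolding net_outflow_add y(2)[OF that] z(2) by (simp add: d'_def)
    then show ?thesis using y(1) z(1) by (intro exI[of _ "\<lambda>e. y e + z e"]) auto
  qed
qed

lemma exists_weakly_feasible:
  assumes "(\<Sum>v \<in> verts G. d v) = 0" "\<not> (\<exists>C. fatal_cut G d cap C)"
  shows "\<exists>x. weakly_feasible G d x"
proof -
  have "(\<Sum>v \<in> X. d v) \<le> 0" if X: "out_closed G X" for X
  proof (cases "X = {} \<or> X = verts G")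
    case True
    then show ?thesis using assms(1) by auto
  next
    case False
    then have "is_cut G (X, verts G - X)" using X by (auto simp: is_cut_def out_closed_def)
    moreover have "cut_arcs G (X, verts G - X) = {}"
      using X by (auto simp: cut_arcs_def out_closed_def)
    ultimately have "\<not> cut_demand d (X, verts G - X) > 0"
      using assms(2) by (metis cut_capacity_def fatal_cut_def sum.empty)
    then show ?thesis by (simp add: cut_demand_def)
  qed
  then obtain y where y: "\<And>e. y e \<ge> 0" "\<And>v. v \<in> verts G \<Longrightarrow> net_outflow G y v = d v"
    using exists_nonneg_with_net_outflow[OF assms(1)] by blast
  have "net_outflow G (restrict y (arcs G)) v = d v" if "v \<in> verts G" for v
    using y(2)[OF that] net_outflow_cong[of G "restrict y (arcs G)" y v] by simp
  then show ?thesis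
    using y(1) by (intro exI[of _ "restrict y (arcs G)"])
      (auto simp: weakly_feasible_altdef flow_def)
qed

end

section \<open>Sums of the largest values\<close>

definition decreasing_values :: "'b set \<Rightarrow> ('b \<Rightarrow> real) \<Rightarrow> real list" where
  "decreasing_values E r = rev (sorted_list_of_multiset (image_mset r (mset_set E)))"

definition top_sum :: "'b set \<Rightarrow> nat \<Rightarrow> ('b \<Rightarrow> real) \<Rightarrow> real" where
  "top_sum E k r = Max ((\<lambda>A. \<Sum>e \<in> A. r e) ` {A. A \<subseteq> E \<and> card A = k})"

lemma sorted_ratios_eq:
  "sorted_ratios G cap x = decreasing_values (arcs G) (\<lambda>e. x e / cap e)"
  by (simp add: sorted_ratios_def decreasing_values_def)

lemma mset_decreasing_values: "mset (decreasing_values E r) = image_mset r (mset_set E)"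
  by (simp add: decreasing_values_def)

lemma length_decreasing_values: "length (decreasing_values E r) = card E"
  by (metis mset_decreasing_values size_image_mset size_mset size_mset_set)

lemma obtain_decreasing_enumeration:
  fixes r :: "'b \<Rightarrow> real"
  assumes "finite E"
  obtains es where "set es = E" "distinct es" "map r es = decreasing_values E r"
    "sorted_wrt (\<ge>) (map r es)"
proof -
  obtain l where l: "set l = E" "distinct l" using finite_distinct_list[OF assms] by blast
  define es where "es = rev (sort_key r l)"
  have "mset_set E = mset l" using l by (metis mset_set_set)
  then have "mset (map r (sort_key r l)) = image_mset r (mset_set E)" by simp
  then have "sorted_list_of_multiset (image_mset r (mset_set E)) = map r (sort_key r l)"
    by (metis sorted_list_of_multiset_mset sorted_sort_id sorted_sort_key)
  then have "map r es = decreasing_values E r"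
    by (simp add: es_def decreasing_values_def rev_map)
  moreover have "sorted_wrt (\<ge>) (map r es)"
    unfolding es_def rev_map[symmetric] sorted_wrt_rev by simp
  ultimately show thesis using l that[of es] by (simp add: es_def)
qed

text \<open>
  Exchanging the elements outside \<open>T\<close> for those that \<open>A\<close> misses crosses the threshold upwards every time.
\<close>

lemma sum_le_of_threshold:
  fixes r :: "'b \<Rightarrow> real"
  assumes "finite A" "finite T" "card A = card T"
    and "\<And>e. e \<in> T \<Longrightarrow> r e \<ge> t" "\<And>e. e \<in> A - T \<Longrightarrow> r e \<le> t"
  shows "(\<Sum>e \<in> A. r e) \<le> (\<Sum>e \<in> T. r e)"
proof -
  have "card (A - T) = card (T - A)"
    using assms(1-3) by (metis Int_commute card_Diff_subset_Int finite_Int)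
  have "(\<Sum>e \<in> A - T. r e) \<le> of_nat (card (A - T)) * t"
    using assms(5) by (rule sum_bounded_above)
  also have "\<dots> = of_nat (card (T - A)) * t" using \<open>card (A - T) = _\<close> by simp
  also have "\<dots> \<le> (\<Sum>e \<in> T - A. r e)"
    using assms(4) by (intro sum_bounded_below) auto
  finally have "(\<Sum>e \<in> A - T. r e) \<le> (\<Sum>e \<in> T - A. r e)" .
  moreover have "(\<Sum>e \<in> A. r e) = (\<Sum>e \<in> A \<inter> T. r e) + (\<Sum>e \<in> A - T. r e)"
    using sum.Int_Diff[OF assms(1)] .
  moreover have "(\<Sum>e \<in> T. r e) = (\<Sum>e \<in> A \<inter> T. r e) + (\<Sum>e \<in> T - A. r e)"
    using sum.Int_Diff[OF assms(2), of r A] by (simp add: Int_commute)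
  ultimately show ?thesis by linarith
qed

text \<open>
  The \<open>k\<close> largest values form a best \<open>k\<close>-element set, the \<open>k\<close>-th largest value being a threshold between
  them and the rest. This identity replaces sorting by a maximum of finitely many linear functions, which
  is what makes continuity and convexity available.
\<close>

lemma top_sum_eq_prefix_sum:
  assumes "finite E" "k \<le> card E"
  shows "top_sum E k r = sum_list (take k (decreasing_values E r))"
proof -
  obtain es where es: "set es = E" "distinct es" "map r es = decreasing_values E r"
    "sorted_wrt (\<ge>) (map r es)"
    using obtain_decreasing_enumeration[OF assms(1), where r = r] .
  have len: "length es = card E" using es by (metis distinct_card)
  define T where "T = set (take k es)"
  have T: "T \<subseteq> E" "card T = k" "finite T"
    using es assms(2) len by (auto simp: T_def distinct_card dest: in_set_takeD)
  have sumT: "(\<Sum>e \<in> T. r e) = sum_list (take k (decreasing_values E r))"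
    using es(2) by (simp add: T_def take_map sum_list_distinct_conv_sum_set flip: es(3))
  have "(\<Sum>e \<in> A. r e) \<le> (\<Sum>e \<in> T. r e)" if A: "A \<subseteq> E" "card A = k" for A
  proof (cases k)
    case 0
    then show ?thesis using A T finite_subset[OF A(1) assms(1)] by simp
  next
    case (Suc m)
    have mono: "r (es ! j) \<le> r (es ! i)" if "i \<le> j" "j < length es" for i j
      using es(4) that by (cases "i = j") (auto simp: sorted_wrt_iff_nth_less)
    show ?thesis
    proof (rule sum_le_of_threshold[where t = "r (es ! m)"])
      fix e assume "e \<in> T"
      then obtain i where "i < k" "i < length es" "e = es ! i"
        by (auto simp: T_def in_set_conv_nth)
      then show "r (es ! m) \<le> r e" using mono[of i m] Suc assms(2) len by simp
    next
      fix e assume e: "e \<in> A - T"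
      then obtain j where j: "j < length es" "e = es ! j"
        using A(1) es(1) by (metis DiffD1 in_set_conv_nth subsetD)
      have "\<not> j < k" using e j by (auto simp: T_def in_set_conv_nth)
      then show "r e \<le> r (es ! m)" using mono[of m j] j Suc by simp
    qed (use A T finite_subset[OF A(1) assms(1)] in auto)
  qed
  moreover have "finite {A. A \<subseteq> E \<and> card A = k}" using assms(1) by simp
  ultimately have "top_sum E k r = (\<Sum>e \<in> T. r e)"
    unfolding top_sum_def using T by (intro Max_eqI) auto
  then show ?thesis using sumT by simp
qed

lemma top_sum_ge:
  assumes "finite E" "A \<subseteq> E" "card A = k"
  shows "(\<Sum>e \<in> A. r e) \<le> top_sum E k r"
  unfolding top_sum_def using assms by (intro Max_ge) auto

lemma top_sum_leI:
  assumes "finite E" "k \<le> card E"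
    and "\<And>A. A \<subseteq> E \<Longrightarrow> card A = k \<Longrightarrow> (\<Sum>e \<in> A. r e) \<le> c"
  shows "top_sum E k r \<le> c"
proof -
  obtain A where "A \<subseteq> E" "card A = k" using obtain_subset_with_card_n[OF assms(2)] by metis
  then show ?thesis unfolding top_sum_def using assms by (subst Max_le_iff) auto
qed

lemma top_sum_midpoint_le:
  assumes "finite E" "k \<le> card E"
  shows "top_sum E k (\<lambda>e. (r e + s e) / 2) \<le> (top_sum E k r + top_sum E k s) / 2"
proof (rule top_sum_leI[OF assms])
  fix A assume A: "A \<subseteq> E" "card A = k"
  have "(\<Sum>e \<in> A. (r e + s e) / 2) = ((\<Sum>e \<in> A. r e) + (\<Sum>e \<in> A. s e)) / 2"
    by (simp add: sum.distrib flip: sum_divide_distrib)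
  then show "(\<Sum>e \<in> A. (r e + s e) / 2) \<le> (top_sum E k r + top_sum E k s) / 2"
    using top_sum_ge[OF assms(1) A, of r] top_sum_ge[OF assms(1) A, of s] by simp
qed

lemma continuous_on_Max_image:
  fixes f :: "'i \<Rightarrow> 'x::topological_space \<Rightarrow> real"
  assumes "finite I" "I \<noteq> {}" "\<And>i. i \<in> I \<Longrightarrow> continuous_on S (f i)"
  shows "continuous_on S (\<lambda>x. Max ((\<lambda>i. f i x) ` I))"
  using assms
proof (induction I rule: finite_ne_induct)
  case (insert i I)
  then have "continuous_on S (\<lambda>x. max (f i x) (Max ((\<lambda>i. f i x) ` I)))"
    by (intro continuous_on_max) auto
  then show ?case using insert by simp
qed simp

lemma continuous_on_top_sum:
  assumes "finite E" "k \<le> card E" "\<And>e. e \<in> E \<Longrightarrow> continuous_on S (\<lambda>x. r x e)"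
  shows "continuous_on S (\<lambda>x. top_sum E k (r x))"
  unfolding top_sum_def
proof (rule continuous_on_Max_image)
  show "{A. A \<subseteq> E \<and> card A = k} \<noteq> {}" using obtain_subset_with_card_n[OF assms(2)] by blast
qed (use assms in \<open>auto intro!: continuous_on_sum\<close>)

section \<open>Lexicographic minimization\<close>

text \<open>
  The map from a list to its prefix sums is triangular with unit diagonal: at the first position where two
  lists differ, their prefix sums differ for the first time and in the same direction. The hypothesis is
  lexicographic comparison of the prefix sums, with \<open>k\<close> in the role of the first difference.
\<close>

lemma lexordp_eq_if_prefix_sums:
  fixes xs ys :: "real list"
  assumes "length xs = length ys"
    and "\<And>k. k \<le> length xs \<Longrightarrow>
      (\<And>i. i < k \<Longrightarrow> sum_list (take i ys) = sum_list (take i xs)) \<Longrightarrow>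
      sum_list (take k xs) \<le> sum_list (take k ys)"
  shows "ord_class.lexordp_eq xs ys"
  using assms
proof (induction xs ys rule: list_induct2)
  case (Cons x xs y ys)
  have "x \<le> y" using Cons.prems[of 1] by simp
  moreover have "ord_class.lexordp_eq xs ys" if "x = y"
  proof (rule Cons.IH)
    fix k assume k: "k \<le> length xs"
      "\<And>i. i < k \<Longrightarrow> sum_list (take i ys) = sum_list (take i xs)"
    have "sum_list (take i (y # ys)) = sum_list (take i (x # xs))" if "i < Suc k" for i
      using that k(2) \<open>x = y\<close> by (cases i) auto
    then show "sum_list (take k xs) \<le> sum_list (take k ys)"
      using Cons.prems[of "Suc k"] k(1) \<open>x = y\<close> by simp
  qed
  ultimately show ?case by (cases "x = y") (auto simp: order_less_le)
qed simp

text \<open>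
  Each objective is minimized over the set where the earlier ones agree with their optimal values; this
  set is again compact and nonempty.
\<close>

lemma compact_lexmin_exists:
  fixes f :: "nat \<Rightarrow> 'x::topological_space \<Rightarrow> real"
  assumes "compact K" "K \<noteq> {}" "\<And>i. i < n \<Longrightarrow> continuous_on UNIV (f i)"
  shows "\<exists>x \<in> K. \<forall>y \<in> K. \<forall>k < n. (\<forall>i < k. f i y = f i x) \<longrightarrow> f k x \<le> f k y"
  using assms(3)
proof (induction n)
  case 0
  then show ?case using assms(2) by auto
next
  case (Suc n)
  then obtain x where x: "x \<in> K"
    "\<And>y k. y \<in> K \<Longrightarrow> k < n \<Longrightarrow> \<forall>i < k. f i y = f i x \<Longrightarrow> f k x \<le> f k y" by (metis less_SucI)
  define L where "L = K \<inter> (\<Inter>i \<in> {..<n}. {y. f i y = f i x})"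
  have "closed (\<Inter>i \<in> {..<n}. {y. f i y = f i x})"
    using Suc.prems by (intro closed_INT ballI closed_Collect_eq continuous_on_const) auto
  then have "compact L" unfolding L_def using assms(1) by blast
  moreover have "x \<in> L" using x(1) by (simp add: L_def)
  moreover have "continuous_on L (f n)"
    using Suc.prems[of n] by (metis continuous_on_subset lessI subset_UNIV)
  ultimately obtain z where z: "z \<in> L" "\<And>y. y \<in> L \<Longrightarrow> f n z \<le> f n y"
    using continuous_attains_inf[of L "f n"] by blast
  have zx: "f i z = f i x" if "i < n" for i using z(1) that by (simp add: L_def)
  have "f k z \<le> f k y" if "y \<in> K" "k < Suc n" "\<forall>i < k. f i y = f i z" for y k
  proof (cases "k = n")
    case True
    then have "y \<in> L" using that zx by (simp add: L_def)
    then show ?thesis using z(2) True by simp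
  next
    case False
    then have k: "k < n" using that(2) by simp
    then have "\<forall>i < k. f i y = f i x" using that(3) zx by simp
    then show ?thesis using x(2)[OF that(1) k] zx[OF k] by simp
  qed
  then show ?case using z(1) by (intro bexI[of _ z]) (auto simp: L_def)
qed

text \<open>
  This is Tychonoff's theorem for the product of the intervals; the singleton factors outside \<open>E\<close> fit the
  convention that a vector indexed by \<open>E\<close> is a function with a fixed value elsewhere.
\<close>

lemma compact_box_functions:
  "compact {x :: 'b \<Rightarrow> real. (\<forall>e \<in> E. 0 \<le> x e \<and> x e \<le> b e) \<and> (\<forall>e. e \<notin> E \<longrightarrow> x e = c)}"
proof -
  define S where "S = (\<lambda>e. if e \<in> E then {0..b e} else {c})"
  have "compactin (product_topology (\<lambda>_. euclidean) UNIV) (PiE UNIV S)"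
    by (subst compactin_PiE) (auto simp: S_def)
  then have "compact (PiE UNIV S)" by (simp add: euclidean_product_topology)
  also have "PiE UNIV S =
      {x. (\<forall>e \<in> E. 0 \<le> x e \<and> x e \<le> b e) \<and> (\<forall>e. e \<notin> E \<longrightarrow> x e = c)}"
    by (auto simp: S_def PiE_iff split: if_splits)
  finally show ?thesis .
qed

section \<open>Balanced flows\<close>

context capacitated_digraph
begin

lemma compact_bounded_weakly_feasible:
  "compact {x. weakly_feasible G d x \<and> (\<forall>e \<in> arcs G. x e / cap e \<le> M)}"
proof -
  have proj: "continuous_on UNIV (\<lambda>x::'b \<Rightarrow> real. x e)" for e by simp
  have "closed (\<Inter>v \<in> verts G. {x. net_outflow G x v = d v})"
    unfolding net_outflow_def
    by (intro closed_INT ballI closed_Collect_eq continuous_on_const continuous_on_diff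
        continuous_on_sum proj)
  then have "compact ({x. (\<forall>e \<in> arcs G. 0 \<le> x e \<and> x e \<le> M * cap e) \<and>
      (\<forall>e. e \<notin> arcs G \<longrightarrow> x e = undefined)} \<inter>
      (\<Inter>v \<in> verts G. {x. net_outflow G x v = d v}))"
    by (intro compact_Int_closed compact_box_functions)
  also have "\<dots> = {x. weakly_feasible G d x \<and> (\<forall>e \<in> arcs G. x e / cap e \<le> M)}"
    using cap_pos by (auto simp: weakly_feasible_altdef flow_def PiE_iff extensional_def
        pos_divide_le_eq)
  finally show ?thesis .
qed

text \<open>
  The weakly feasible flows may form an unbounded set. Cutting off at the largest ratio \<open>M\<close> of the given
  flow loses nothing, since a flow with a ratio above \<open>M\<close> is already worse in the first coordinate.
\<close>

lemma balanced_flow_exists: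
  assumes "weakly_feasible G d x0"
  shows "\<exists>x. balanced_flow G d cap x"
proof -
  define r where "r = (\<lambda>x e. x e / cap e)"
  \<comment> \<open>Inserting \<open>0\<close> only gives the maximum a meaning when there are no arcs.\<close>
  define M where "M = Max (insert 0 (r x0 ` arcs G))"
  define K where "K = {x. weakly_feasible G d x \<and> (\<forall>e \<in> arcs G. x e / cap e \<le> M)}"
  define n where "n = card (arcs G)"
  let ?f = "\<lambda>k x. top_sum (arcs G) k (r x)"
  have "r x0 e \<le> M" if "e \<in> arcs G" for e using that by (auto simp: M_def)
  then have "x0 \<in> K" using assms by (auto simp: K_def r_def)
  moreover have "compact K" unfolding K_def by (rule compact_bounded_weakly_feasible)
  moreover have "continuous_on UNIV (?f k)" if "k < Suc n" for k
    using that unfolding r_def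
    by (intro continuous_on_top_sum continuous_on_divide)
      (use cap_pos in \<open>force simp: n_def\<close>)+
  ultimately have "\<exists>x \<in> K. \<forall>y \<in> K. \<forall>k < Suc n. (\<forall>i < k. ?f i y = ?f i x) \<longrightarrow> ?f k x \<le> ?f k y"
    by (intro compact_lexmin_exists) auto
  then obtain x where x: "x \<in> K"
    "\<And>y k. y \<in> K \<Longrightarrow> k \<le> n \<Longrightarrow> (\<And>i. i < k \<Longrightarrow> ?f i y = ?f i x) \<Longrightarrow> ?f k x \<le> ?f k y"
    by (metis less_Suc_eq_le)
  have "?f k x \<le> ?f k y"
    if y: "weakly_feasible G d y" "k \<le> n" "\<And>i. i < k \<Longrightarrow> ?f i y = ?f i x" for y k
  proof (cases "y \<in> K")
    case True
    then show ?thesis using x(2) y by blast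
  next
    case False
    then obtain e where e: "e \<in> arcs G" "r y e > M" using y(1) by (auto simp: K_def r_def not_le)
    have n: "1 \<le> n" using e(1) by (auto simp: n_def Suc_le_eq card_gt_0_iff)
    have "M < (\<Sum>a \<in> {e}. r y a)" using e(2) by simp
    also have "\<dots> \<le> ?f 1 y" using e(1) by (intro top_sum_ge) auto
    finally have 1: "M < ?f 1 y" .
    have 2: "?f 1 x \<le> M"
      using x(1) n by (intro top_sum_leI) (auto simp: n_def K_def r_def card_1_singleton_iff)
    have 0: "?f 0 x = ?f 0 y" by (simp add: top_sum_eq_prefix_sum)
    consider "k = 0" | "k = 1" | "1 < k" by linarith
    then show ?thesis
    proof cases
      case 3
      then show ?thesis using y(3)[of 1] 1 2 by simp
    qed (use 0 1 2 in auto)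
  qed
  then have "ord_class.lexordp_eq (sorted_ratios G cap x) (sorted_ratios G cap y)"
    if "weakly_feasible G d y" for y
    using that unfolding sorted_ratios_eq
    by (intro lexordp_eq_if_prefix_sums)
      (auto simp: length_decreasing_values n_def r_def top_sum_eq_prefix_sum)
  then show ?thesis using x(1) by (auto simp: balanced_flow_def K_def)
qed

lemma weakly_feasible_midpoint:
  assumes "weakly_feasible G d x" "weakly_feasible G d y"
  shows "weakly_feasible G d (restrict (\<lambda>e. (x e + y e) / 2) (arcs G))"
proof -
  let ?z = "restrict (\<lambda>e. (x e + y e) / 2) (arcs G)"
  have "net_outflow G ?z v = d v" if "v \<in> verts G" for v
  proof -
    have "net_outflow G ?z v = net_outflow G (\<lambda>e. (1/2) * (x e + y e)) v"
      by (rule net_outflow_cong) simp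
    also have "\<dots> = d v"
      unfolding net_outflow_mult net_outflow_add
      using assms that by (simp add: weakly_feasible_altdef)
    finally show ?thesis .
  qed
  then show ?thesis using assms by (auto simp: weakly_feasible_altdef flow_def PiE_iff)
qed

lemma balanced_flow_unique:
  assumes "balanced_flow G d cap x" "balanced_flow G d cap y"
  shows "x = y"
proof -
  define z where "z = restrict (\<lambda>e. (x e + y e) / 2) (arcs G)"
  define r where "r = (\<lambda>x e. x e / cap e)"
  let ?L = "\<lambda>x. decreasing_values (arcs G) (r x)"
  have wf: "weakly_feasible G d x" "weakly_feasible G d y"
    using assms by (auto simp: balanced_flow_def)
  then have wfz: "weakly_feasible G d z" unfolding z_def by (rule weakly_feasible_midpoint)
  have min: "ord_class.lexordp_eq (?L x) (?L u)" "ord_class.lexordp_eq (?L y) (?L u)"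
    if "weakly_feasible G d u" for u
    using assms that by (auto simp: balanced_flow_def sorted_ratios_eq r_def)
  have xy: "?L x = ?L y" using min wf by (blast intro: lexordp_eq_antisym)
  have rz: "r z e = (r x e + r y e) / 2" if "e \<in> arcs G" for e
    using that by (simp add: r_def z_def add_divide_distrib)
  have "sum_list (take k (?L z)) \<le> sum_list (take k (?L x))" if k: "k \<le> card (arcs G)" for k
  proof -
    have "top_sum (arcs G) k (r z) = top_sum (arcs G) k (\<lambda>e. (r x e + r y e) / 2)"
      unfolding top_sum_def
      by (intro arg_cong[where f = Max] image_cong sum.cong refl) (use rz in auto)
    also have "\<dots> \<le> (top_sum (arcs G) k (r x) + top_sum (arcs G) k (r y)) / 2"
      using k by (intro top_sum_midpoint_le) auto
    finally show ?thesis using k xy by (simp add: top_sum_eq_prefix_sum)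
  qed
  then have "ord_class.lexordp_eq (?L z) (?L x)"
    by (intro lexordp_eq_if_prefix_sums) (auto simp: length_decreasing_values)
  then have xz: "?L x = ?L z" using min(1)[OF wfz] by (blast intro: lexordp_eq_antisym)
  \<comment> \<open>The Euclidean norm depends only on the multiset of the coordinates.\<close>
  have sq: "(\<Sum>e \<in> arcs G. (r u e)\<^sup>2) = sum_list (map (\<lambda>t. t\<^sup>2) (?L u))" for u
  proof -
    have "sum_list (map (\<lambda>t. t\<^sup>2) (?L u)) = sum_mset (image_mset (\<lambda>t. t\<^sup>2) (mset (?L u)))"
      by (metis mset_map sum_mset_sum_list)
    then show ?thesis
      by (simp add: mset_decreasing_values sum_unfold_sum_mset multiset.map_comp comp_def)
  qed
  \<comment> \<open>The parallelogram law for \<open>r x\<close> and \<open>r y\<close> with midpoint \<open>r z\<close>.\<close>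
  have "(\<Sum>e \<in> arcs G. (r x e - r y e)\<^sup>2) =
      (\<Sum>e \<in> arcs G. 2 * (r x e)\<^sup>2 + 2 * (r y e)\<^sup>2 - 4 * (r z e)\<^sup>2)"
    by (intro sum.cong refl) (simp add: rz power2_eq_square field_simps)
  also have "\<dots> = 2 * (\<Sum>e \<in> arcs G. (r x e)\<^sup>2) + 2 * (\<Sum>e \<in> arcs G. (r y e)\<^sup>2)
      - 4 * (\<Sum>e \<in> arcs G. (r z e)\<^sup>2)"
    by (simp add: sum.distrib sum_subtractf sum_distrib_left)
  also have "\<dots> = 0" unfolding sq xy[symmetric] xz[symmetric] by simp
  finally have "\<forall>e \<in> arcs G. (r x e - r y e)\<^sup>2 = 0"
    by (subst (asm) sum_nonneg_eq_0_iff) auto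
  then have "x e = y e" if "e \<in> arcs G" for e
    using cap_pos[OF that] that by (auto simp: r_def)
  then show ?thesis
    using wf by (auto simp: weakly_feasible_altdef flow_def intro: PiE_ext)
qed

end

theorem corollary4:
  fixes G :: "('a, 'b) pre_digraph" and d :: "'a \<Rightarrow> real" and cap :: "'b \<Rightarrow> real"
  assumes "capacitated_digraph G cap"
    and "(\<Sum>v \<in> verts G. d v) = 0"
    and "\<not> (\<exists>C. fatal_cut G d cap C)"
  shows "\<exists>!x. balanced_flow G d cap x"
proof -
  interpret capacitated_digraph G cap by (rule assms(1))
  obtain x0 where "weakly_feasible G d x0"
    using exists_weakly_feasible[OF assms(2,3)] by blast
  then show ?thesis using balanced_flow_exists balanced_flow_unique by (intro ex_ex1I) blast+
qed

end
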